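(* If $(p^{A\vee},p^{A\wedge})$ is feasible in the Two-Stage model, then there exist $p^{S\vee},y^\vee,p^{S\wedge},y^\wedge$ such that $(p^{A\vee},p^{S\vee},y^\vee,p^{A\wedge},p^{S\wedge},y^\wedge)$ is feasible in the Outer model. Therefore, the optimal value of the Two-Stage model is less than or equal to the optimal value of the Outer model.
   Context: **Distribution system.** $T\ge 1$ is an integer, $S_T=\{1,\dots,T\}$, $\tau>0$. $S_N$ is a finite set of nodes containing node $1$; $S_D,S_G,S_S\subseteq S_N$ are the sets of loads, generators and energy storage systems (ESSs). For each period $t$ the variables are $p_t^A\in\mathbb{R}$ (aggregate power), $p_t^S=(p_{it}^S)_{i\in S_S}$, $e_t^S=(e_{it}^S)_{i\in S_S}$ (stored energy), and $y_t=(p_{it}^D,q_{it}^D,p_{it}^G,q_{it}^G,q_{it}^S,p_{it}^N,q_{it}^N)_{i\in S_N}$; quantities of a device type not present at node $i$ are $0$. Real data are given: $\underline P_{it}^D,\overline P_{it}^D,\eta_{it}^D,\underline P_{it}^G,\overline P_{it}^G,\overline S_{it}^G,\overline S_i^S,\underline E_i^S,\overline E_i^S$, with $\overline P_i^{SD},\overline P_i^{SC}>0$, $\kappa_i^S,\eta_i^{SD},\eta_i^{SC}\in(0,1]$, a convex set $C_N$, and a given initial stored energy $e_0^S=(e_{i0}^S)_{i\in S_S}$. **The set $C_t$.** $C_t$ is the set of $(p_t^A,p_t^S,y_t)$ with: $\underline P_{it}^D\le p_{it}^D\le\overline P_{it}^D$ and $q_{it}^D=\eta_{it}^Dp_{it}^D$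 for $i\in S_D$; $\underline P_{it}^G\le p_{it}^G\le\overline P_{it}^G$ and $(p_{it}^G)^2+(q_{it}^G)^2\le(\overline S_{it}^G)^2$ for $i\in S_G$; $-\overline P_i^{SC}\le p_{it}^S\le\overline P_i^{SD}$ and $(p_{it}^S)^2+(q_{it}^S)^2\le(\overline S_i^S)^2$ for $i\in S_S$; $p_{it}^N=p_{it}^G+p_{it}^S-p_{it}^D$ and $q_{it}^N=q_{it}^G+q_{it}^S-q_{it}^D$ for $i\in S_N$; $p_t^A=p_{1t}^N$; $((p_{it}^N)_{i\in S_N},(q_{it}^N)_{i\in S_N})\in C_N$. It is assumed that $C_t$ is convex and closed. **Operational constraints.** Let $F_i(p)=\max\{p,0\}\tau/\eta_i^{SD}+\min\{p,0\}\tau\eta_i^{SC}$. $(\mathrm{OC}_t)$: $(p_t^A,p_t^S,y_t)\in C_t$; $e_{it}^S=\kappa_i^Se_{i(t-1)}^S-F_i(p_{it}^S)$ and $\underline E_i^S\le e_{it}^S\le\overline E_i^S$ for all $i\in S_S$. **Models.** $\phi:\mathbb{R}^T\times\mathbb{R}^T\to\mathbb{R}$ is a function; both models maximize $\phi(p^{A\vee},p^{A\wedge})$ and the optimal value is the supremum over the feasible set, in $[-\infty,\infty]$. *Two-Stage model:* $(p^{A\vee},p^{A\wedge})\in\mathbb{R}^T\times\mathbb{R}^T$ is feasible if $p_t^{A\vee}\le p_t^{A\wedge}$ for all $t\in S_T$ and for all $p^A\in\prod_{t\in S_T}[p_t^{A\vee},p_t^{A\wedge}]$ there exist $(e_t^S,p_t^S,y_t)_{t\in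 S_T}$ such that $(\mathrm{OC}_t)$ holds for all $t\in S_T$. *Outer model:* $(p^{A\vee},p^{S\vee},y^\vee,p^{A\wedge},p^{S\wedge},y^\wedge)$ is feasible if $p_t^{A\vee}\le p_t^{A\wedge}$ and $(p_t^{A\vee},p_t^{S\vee},y_t^\vee),(p_t^{A\wedge},p_t^{S\wedge},y_t^\wedge)\in C_t$ for all $t\in S_T$, and the quantities defined by $e_{i0}^{S\vee}=e_{i0}^{S\wedge}=e_{i0}^S$, $e_{it}^{S\vee}=\kappa_i^Se_{i(t-1)}^{S\vee}-F_i(p_{it}^{S\vee})$, $e_{it}^{S\wedge}=\kappa_i^Se_{i(t-1)}^{S\wedge}-F_i(p_{it}^{S\wedge})$ satisfy $\underline E_i^S\le e_{it}^{S\vee}\le\overline E_i^S$ and $\underline E_i^S\le e_{it}^{S\wedge}\le\overline E_i^S$ for all $i\in S_S$, $t\in S_T$. *)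

theory Defs
  imports "HOL-Analysis.Analysis"
begin

text \<open>
  The node set is the finite type \<open>'n\<close>, so that the library notions of convexity and closedness apply to
  vectors indexed by nodes. A family indexed by the nodes carrying one type of device is a vector in
  \<open>real ^ 'n\<close> whose entries at all other nodes are \<open>0\<close>.
  Families indexed by the periods \<open>{1..T}\<close> are functions on \<open>nat\<close>; where a family is part of a
  solution, it is taken in \<open>{1..T} \<rightarrow>\<^sub>E UNIV\<close>, so that \<open>{1..T} \<rightarrow>\<^sub>E (UNIV :: real set)\<close> is
  $T$-dimensional real space.
  In the data, entries at periods outside \<open>{1..T}\<close> or at nodes without the device are never used.
\<close>

record ('n::finite) system =
  T :: nat
  tau :: real
  node1 :: 'n
  loads :: "'n set"
  gens :: "'n set"
  esss :: "'n set"
  PDmin :: "nat \<Rightarrow> 'n \<Rightarrow> real"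
  PDmax :: "nat \<Rightarrow> 'n \<Rightarrow> real"
  etaD :: "nat \<Rightarrow> 'n \<Rightarrow> real"
  PGmin :: "nat \<Rightarrow> 'n \<Rightarrow> real"
  PGmax :: "nat \<Rightarrow> 'n \<Rightarrow> real"
  SGmax :: "nat \<Rightarrow> 'n \<Rightarrow> real"
  SSmax :: "'n \<Rightarrow> real"
  PSDmax :: "'n \<Rightarrow> real"
  PSCmax :: "'n \<Rightarrow> real"
  Emin :: "'n \<Rightarrow> real"
  Emax :: "'n \<Rightarrow> real"
  kappa :: "'n \<Rightarrow> real"
  etaSD :: "'n \<Rightarrow> real"
  etaSC :: "'n \<Rightarrow> real"
  CN :: "((real ^ 'n) \<times> (real ^ 'n)) set"
  e0 :: "real ^ 'n"

abbreviation periods :: "'n::finite system \<Rightarrow> nat set" where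
  "periods D \<equiv> {1..T D}"

text \<open>The components are \<open>(pD, qD, pG, qG, qS, pN, qN)\<close>.\<close>

type_synonym 'n node_vars =
  "(real ^ 'n) \<times> (real ^ 'n) \<times> (real ^ 'n) \<times> (real ^ 'n) \<times> (real ^ 'n) \<times> (real ^ 'n) \<times> (real ^ 'n)"

definition C :: "'n::finite system \<Rightarrow> nat \<Rightarrow> (real \<times> (real ^ 'n) \<times> 'n node_vars) set" where
  "C D t = {(pA, pS, pD, qD, pG, qG, qS, pN, qN).
     (\<forall>i\<in>loads D. PDmin D t i \<le> pD $ i \<and> pD $ i \<le> PDmax D t i \<and> qD $ i = etaD D t i * pD $ i) \<and>
     (\<forall>i\<in>gens D. PGmin D t i \<le> pG $ i \<and> pG $ i \<le> PGmax D t i \<and>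
        (pG $ i)\<^sup>2 + (qG $ i)\<^sup>2 \<le> (SGmax D t i)\<^sup>2) \<and>
     (\<forall>i\<in>esss D. - PSCmax D i \<le> pS $ i \<and> pS $ i \<le> PSDmax D i \<and>
        (pS $ i)\<^sup>2 + (qS $ i)\<^sup>2 \<le> (SSmax D i)\<^sup>2) \<and>
     (\<forall>i. i \<notin> loads D \<longrightarrow> pD $ i = 0 \<and> qD $ i = 0) \<and>
     (\<forall>i. i \<notin> gens D \<longrightarrow> pG $ i = 0 \<and> qG $ i = 0) \<and>
     (\<forall>i. i \<notin> esss D \<longrightarrow> pS $ i = 0 \<and> qS $ i = 0) \<and>
     (\<forall>i. pN $ i = pG $ i + pS $ i - pD $ i \<and> qN $ i = qG $ i + qS $ i - qD $ i) \<and>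
     pA = pN $ node1 D \<and>
     (pN, qN) \<in> CN D}"

definition distribution_system :: "'n::finite system \<Rightarrow> bool" where
  "distribution_system D \<longleftrightarrow>
     T D \<ge> 1 \<and> tau D > 0 \<and>
     (\<forall>i\<in>esss D. PSDmax D i > 0 \<and> PSCmax D i > 0 \<and>
        kappa D i \<in> {0<..1} \<and> etaSD D i \<in> {0<..1} \<and> etaSC D i \<in> {0<..1}) \<and>
     convex (CN D) \<and>
     (\<forall>t\<in>periods D. convex (C D t) \<and> closed (C D t))"

definition F :: "'n::finite system \<Rightarrow> 'n \<Rightarrow> real \<Rightarrow> real" where
  "F D i p = max p 0 * tau D / etaSD D i + min p 0 * tau D * etaSC D i"

text \<open>The argument \<open>e'\<close> is the vector of stored energies at the end of the preceding period.\<close>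

definition OC :: "'n::finite system \<Rightarrow> nat \<Rightarrow> real \<Rightarrow> real ^ 'n \<Rightarrow> real ^ 'n \<Rightarrow> real ^ 'n \<Rightarrow> 'n node_vars \<Rightarrow> bool" where
  "OC D t pA e' e pS y \<longleftrightarrow>
     (pA, pS, y) \<in> C D t \<and>
     (\<forall>i\<in>esss D. e $ i = kappa D i * e' $ i - F D i (pS $ i) \<and> Emin D i \<le> e $ i \<and> e $ i \<le> Emax D i) \<and>
     (\<forall>i. i \<notin> esss D \<longrightarrow> e $ i = 0)"

definition two_stage_feasible :: "'n::finite system \<Rightarrow> ((nat \<Rightarrow> real) \<times> (nat \<Rightarrow> real)) set" where
  "two_stage_feasible D = {(pAlo, pAup).
     pAlo \<in> periods D \<rightarrow>\<^sub>E UNIV \<and> pAup \<in> periods D \<rightarrow>\<^sub>E UNIV \<and>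
     (\<forall>t\<in>periods D. pAlo t \<le> pAup t) \<and>
     (\<forall>pA \<in> (\<Pi>\<^sub>E t\<in>periods D. {pAlo t..pAup t}).
        \<exists>e \<in> periods D \<rightarrow>\<^sub>E UNIV. \<exists>pS \<in> periods D \<rightarrow>\<^sub>E UNIV. \<exists>y \<in> periods D \<rightarrow>\<^sub>E UNIV.
          \<forall>t\<in>periods D. OC D t (pA t) (if t = 1 then e0 D else e (t - 1)) (e t) (pS t) (y t))}"

primrec energy :: "'n::finite system \<Rightarrow> (nat \<Rightarrow> real ^ 'n) \<Rightarrow> 'n \<Rightarrow> nat \<Rightarrow> real" where
  "energy D pS i 0 = e0 D $ i"
| "energy D pS i (Suc t) = kappa D i * energy D pS i t - F D i (pS (Suc t) $ i)"

definition outer_feasible ::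
  "'n::finite system \<Rightarrow>
     ((nat \<Rightarrow> real) \<times> (nat \<Rightarrow> real ^ 'n) \<times> (nat \<Rightarrow> 'n node_vars) \<times>
      (nat \<Rightarrow> real) \<times> (nat \<Rightarrow> real ^ 'n) \<times> (nat \<Rightarrow> 'n node_vars)) set" where
  "outer_feasible D = {(pAlo, pSlo, ylo, pAup, pSup, yup).
     pAlo \<in> periods D \<rightarrow>\<^sub>E UNIV \<and> pSlo \<in> periods D \<rightarrow>\<^sub>E UNIV \<and> ylo \<in> periods D \<rightarrow>\<^sub>E UNIV \<and>
     pAup \<in> periods D \<rightarrow>\<^sub>E UNIV \<and> pSup \<in> periods D \<rightarrow>\<^sub>E UNIV \<and> yup \<in> periods D \<rightarrow>\<^sub>E UNIV \<and>
     (\<forall>t\<in>periods D. pAlo t \<le> pAup t \<and>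
        (pAlo t, pSlo t, ylo t) \<in> C D t \<and> (pAup t, pSup t, yup t) \<in> C D t) \<and>
     (\<forall>i\<in>esss D. \<forall>t\<in>periods D.
        Emin D i \<le> energy D pSlo i t \<and> energy D pSlo i t \<le> Emax D i \<and>
        Emin D i \<le> energy D pSup i t \<and> energy D pSup i t \<le> Emax D i)}"

definition two_stage_value ::
  "'n::finite system \<Rightarrow> ((nat \<Rightarrow> real) \<Rightarrow> (nat \<Rightarrow> real) \<Rightarrow> real) \<Rightarrow> ereal" where
  "two_stage_value D \<phi> = (SUP (pAlo, pAup) \<in> two_stage_feasible D. ereal (\<phi> pAlo pAup))"

definition outer_value ::
  "'n::finite system \<Rightarrow> ((nat \<Rightarrow> real) \<Rightarrow> (nat \<Rightarrow> real) \<Rightarrow> real) \<Rightarrow> ereal" where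
  "outer_value D \<phi> =
     (SUP (pAlo, pSlo, ylo, pAup, pSup, yup) \<in> outer_feasible D. ereal (\<phi> pAlo pAup))"

end

theory Submission
  imports Defs
begin

text \<open>The robust requirement of the Two-Stage model covers every aggregate profile in the box
  between \<open>pAlo\<close> and \<open>pAup\<close>, in particular the two extreme profiles
  \<open>pAlo\<close> and \<open>pAup\<close> themselves. The responses to these two profiles are
  the two trajectories that the Outer model asks for (\<open>two_stage_feasible_trajectory\<close>).
  One mismatch remains: stored energy is a chosen variable \<open>e\<close> in one model and the
  computed quantity \<open>energy\<close> in the other. \<open>energy_eq_stored_energy\<close>
  identifies them, since the storage recursion and the initial value determine the energy. The
  optimal values then compare because the objective sees only \<open>pAlo\<close> and
  \<open>pAup\<close>, which are kept.\<close>

lemma energy_eq_stored_energy: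
  assumes OC: "\<forall>t\<in>periods D. OC D t (pA t) (if t = 1 then e0 D else e (t - 1)) (e t) (pS t) (y t)"
    and i: "i \<in> esss D"
    and t: "t \<in> periods D"
  shows "energy D pS i t = e t $ i"
  using t
proof (induction t)
  case 0
  then show ?case by simp
next
  case (Suc t)
  have "e (Suc t) $ i =
      kappa D i * (if Suc t = 1 then e0 D else e (Suc t - 1)) $ i - F D i (pS (Suc t) $ i)"
    using OC Suc.prems i unfolding OC_def by blast
  \<comment> \<open>The induction really starts at period 1, whose predecessor energy is
    \<open>e0 D\<close> and not \<open>e 0\<close>. So for \<open>t = 0\<close> the equation is the
    initial value of \<open>energy\<close>; for larger \<open>t\<close> the period lies in
    \<open>periods D\<close> and the induction hypothesis applies.\<close>
  moreover have "energy D pS i t = (if Suc t = 1 then e0 D else e (Suc t - 1)) $ i"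
    using Suc by (cases t) auto
  ultimately show ?case by simp
qed

text \<open>The response to a single profile, with the variable \<open>e\<close> eliminated in
  favour of \<open>energy\<close>. This is half of an Outer solution, so it is used once for each
  extreme profile.\<close>

lemma two_stage_feasible_trajectory:
  assumes feasible: "(pAlo, pAup) \<in> two_stage_feasible D"
    and pA: "pA \<in> (\<Pi>\<^sub>E t\<in>periods D. {pAlo t..pAup t})"
  obtains pS y where "pS \<in> periods D \<rightarrow>\<^sub>E UNIV" and "y \<in> periods D \<rightarrow>\<^sub>E UNIV"
    and "\<forall>t\<in>periods D. (pA t, pS t, y t) \<in> C D t"
    and "\<forall>i\<in>esss D. \<forall>t\<in>periods D. Emin D i \<le> energy D pS i t \<and> energy D pS i t \<le> Emax D i"
proof -
  obtain e pS y where pS: "pS \<in> periods D \<rightarrow>\<^sub>E UNIV" and y: "y \<in> periods D \<rightarrow>\<^sub>E UNIV"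
    and OC: "\<forall>t\<in>periods D. OC D t (pA t) (if t = 1 then e0 D else e (t - 1)) (e t) (pS t) (y t)"
    using feasible pA unfolding two_stage_feasible_def by blast
  have "\<forall>t\<in>periods D. (pA t, pS t, y t) \<in> C D t"
    using OC unfolding OC_def by blast
  \<comment> \<open>Replacing \<open>energy\<close> by \<open>e\<close> turns these into the bounds
    contained in \<open>OC\<close>.\<close>
  moreover have "Emin D i \<le> energy D pS i t \<and> energy D pS i t \<le> Emax D i"
    if "i \<in> esss D" "t \<in> periods D" for i t
    using OC that unfolding energy_eq_stored_energy[OF OC that] OC_def by blast
  ultimately show ?thesis
    using that pS y by blast
qed

lemma two_stage_feasible_imp_outer_feasible:
  assumes feasible: "(pAlo, pAup) \<in> two_stage_feasible D"
  shows "\<exists>pSlo ylo pSup yup. (pAlo, pSlo, ylo, pAup, pSup, yup) \<in> outer_feasible D"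
proof -
  have lo: "pAlo \<in> periods D \<rightarrow>\<^sub>E UNIV" and up: "pAup \<in> periods D \<rightarrow>\<^sub>E UNIV"
    and le: "\<forall>t\<in>periods D. pAlo t \<le> pAup t"
    using feasible unfolding two_stage_feasible_def by blast+
  \<comment> \<open>Both corners lie in the box because \<open>pAlo t \<le> pAup t\<close>; being
    undefined outside \<open>periods D\<close> is part of membership and comes from
    \<open>lo\<close> and \<open>up\<close>.\<close>
  have lo_mem: "pAlo \<in> (\<Pi>\<^sub>E t\<in>periods D. {pAlo t..pAup t})"
    using lo le by (simp add: PiE_iff)
  have up_mem: "pAup \<in> (\<Pi>\<^sub>E t\<in>periods D. {pAlo t..pAup t})"
    using up le by (simp add: PiE_iff)
  show ?thesis
    using two_stage_feasible_trajectory[OF feasible lo_mem]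
      two_stage_feasible_trajectory[OF feasible up_mem] lo up le
    unfolding outer_feasible_def mem_Collect_eq prod.case by metis
qed

theorem proposition9:
  fixes D :: "'n::finite system"
    and \<phi> :: "(nat \<Rightarrow> real) \<Rightarrow> (nat \<Rightarrow> real) \<Rightarrow> real"
  assumes "distribution_system D"
  shows "(\<forall>pAlo pAup. (pAlo, pAup) \<in> two_stage_feasible D \<longrightarrow>
            (\<exists>pSlo ylo pSup yup. (pAlo, pSlo, ylo, pAup, pSup, yup) \<in> outer_feasible D)) \<and>
         two_stage_value D \<phi> \<le> outer_value D \<phi>"
proof
  show "\<forall>pAlo pAup. (pAlo, pAup) \<in> two_stage_feasible D \<longrightarrow>
            (\<exists>pSlo ylo pSup yup. (pAlo, pSlo, ylo, pAup, pSup, yup) \<in> outer_feasible D)"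
    using two_stage_feasible_imp_outer_feasible by blast
  show "two_stage_value D \<phi> \<le> outer_value D \<phi>"
    unfolding two_stage_value_def outer_value_def
  \<comment> \<open>Each Two-Stage point is matched by an Outer point with the same objective
    value.\<close>
  proof (rule SUP_mono)
    fix x assume "x \<in> two_stage_feasible D"
    then obtain pAlo pAup pSlo ylo pSup yup where "x = (pAlo, pAup)"
      and "(pAlo, pSlo, ylo, pAup, pSup, yup) \<in> outer_feasible D"
      using two_stage_feasible_imp_outer_feasible by (cases x) blast
    then show "\<exists>z\<in>outer_feasible D. (case x of (pAlo, pAup) \<Rightarrow> ereal (\<phi> pAlo pAup)) \<le>
        (case z of (pAlo, pSlo, ylo, pAup, pSup, yup) \<Rightarrow> ereal (\<phi> pAlo pAup))"
      by (intro bexI[where x = "(pAlo, pSlo, ylo, pAup, pSup, yup)"]) simp_all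
  qed
qed

end
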